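(* Let $1\leqslant p<\infty$, $X=\ell^p(\mathbb{N})$, $0<c<c'$, and let $(\alpha_n)_{n\geqslant1}$ be a sequence with $\alpha_n\in(c,c')$ for all $n$. Let $L:X\to X$, $L((x_n)_{n\geqslant 1})=(\alpha_nx_{n+1})_{n\geqslant 1}$, be the associated backward weighted shift, and suppose that $L$ is strongly transitive. Let $\mu$ be a fully supported Borel probability measure on $\mathbb{R}$, let $S(x)=(\alpha_1^{-1}x_1,\alpha_2^{-1}x_2,\ldots)$, let $\mathsf{M}=(\mu\times\delta_{S(x)})_{x\in X}$, and let $f\in C_b(X,\mathbb{R})$. Then every conformal measure with respect to $\mathscr{L}_{\mathsf{M},f}$ is fully supported, i.e. gives positive mass to every nonempty open subset of $X$.
   Context: $C_b(X,\mathbb{R})$ is the space of bounded continuous real functions with the supremum norm. $L$ is strongly transitive if for every nonempty open set $U\subset X$ one has $X\setminus\{0\}\subset\bigcup_{n=1}^\infty L^n(U)$. Identifying $\mathbb{R}\times\ell^p(\mathbb{N})$ with $\ell^p(\mathbb{N})$ via $(r,y)\mapsto(r,y_1,y_2,\ldots)$, the measure $\mu\times\delta_{S(x)}$ is the law of $(r,x_1/\alpha_1,x_2/\alpha_2,\ldots)$ with $r$ distributed according to $\mu$, and the transfer operator on $C_b(X,\mathbb{R})$ is $$\mathscr{L}_{\mathsf{M},f}\varphi(x)=\int_{\mathbb{R}}e^{f(r,\frac{x_1}{\alpha_1},\frac{x_2}{\alpha_2},\ldots)}\varphi\bigl(r,\tfrac{x_1}{\alpha_1},\tfrac{x_2}{\alpha_2},\ldots\bigr)\,d\mu(r).$$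 A conformal measure is a Borel probability measure $\nu$ on $X$ with $\mathscr{L}_{\mathsf{M},f}^*\nu=\varrho\nu$, i.e. $\int\mathscr{L}_{\mathsf{M},f}\varphi\,d\nu=\varrho\int\varphi\,d\nu$ for all $\varphi\in C_b(X,\mathbb{R})$, where $\varrho$ is the spectral radius of $\mathscr{L}_{\mathsf{M},f}$ on $C_b(X,\mathbb{R})$. *)

theory Defs
  imports "HOL-Analysis.Analysis" "HOL-Probability.Probability"
begin

section \<open>The sequence space \<open>\<ell>\<^sup>p\<close>\<close>

text \<open>
  Since the exponent is an arbitrary real number, \<open>\<ell>\<^sup>p\<close> is a carrier set of real
  sequences, not a type. Coordinates are indexed from 0: \<open>x n\<close> is the
  mathematical \<open>x\<close> with index \<open>n + 1\<close>, and similarly for the weights.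
\<close>

definition lp :: "real \<Rightarrow> (nat \<Rightarrow> real) set" where
  "lp p = {x. summable (\<lambda>n. \<bar>x n\<bar> powr p)}"

definition lp_norm :: "real \<Rightarrow> (nat \<Rightarrow> real) \<Rightarrow> real" where
  "lp_norm p x = (\<Sum>n. \<bar>x n\<bar> powr p) powr (1 / p)"

definition lp_dist :: "real \<Rightarrow> (nat \<Rightarrow> real) \<Rightarrow> (nat \<Rightarrow> real) \<Rightarrow> real" where
  "lp_dist p x y = lp_norm p (\<lambda>n. x n - y n)"

definition lp_topology :: "real \<Rightarrow> (nat \<Rightarrow> real) topology" where
  "lp_topology p = Metric_space.mtopology (lp p) (lp_dist p)"

lemma powr_convex_nonneg:
  fixes p s t u v :: real
  assumes p: "1 \<le> p" and st: "0 \<le> s" "0 \<le> t" "s + t = 1" and uv: "0 \<le> u" "0 \<le> v"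
  shows "(s * u + t * v) powr p \<le> s * u powr p + t * v powr p"
proof -
  have z: "(t * v) powr p \<le> t * v powr p" if "0 \<le> t" "t \<le> 1" "0 \<le> v" for t v :: real
  proof -
    have "t powr p \<le> t powr 1"
      using that p powr_mono'[of 1 p t] by (cases "t = 0") auto
    then show ?thesis
      using that by (simp add: powr_mult mult_right_mono)
  qed
  show ?thesis
  proof (cases "u = 0 \<or> v = 0")
    case True
    then show ?thesis using z[of s u] z[of t v] st uv p by auto
  next
    case False
    have "s = 1 - t" using st by simp
    then show ?thesis
      using convex_onD[OF powr_convex[OF p], of t u v] st uv False by (simp only:) simp
  qed
qed

lemma lp_minkowski:
  assumes p: "1 \<le> p" and x: "x \<in> lp p" and y: "y \<in> lp p"
  shows "(\<lambda>n. x n + y n) \<in> lp p"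
    and "lp_norm p (\<lambda>n. x n + y n) \<le> lp_norm p x + lp_norm p y"
proof -
  have main: "summable (\<lambda>n. \<bar>x n + y n\<bar> powr p) \<and> lp_norm p (\<lambda>n. x n + y n) \<le> A + B"
    if A: "lp_norm p x \<le> A" "0 < A" and B: "lp_norm p y \<le> B" "0 < B" for A B
  proof -
    define s t where "s = A / (A + B)" and "t = B / (A + B)"
    have st: "0 \<le> s" "0 \<le> t" "s + t = 1"
      using A B by (auto simp: s_def t_def add_divide_distrib[symmetric])
    let ?b = "\<lambda>n. (A + B) powr p * (s * (\<bar>x n\<bar> powr p / A powr p) + t * (\<bar>y n\<bar> powr p / B powr p))"
    have le: "\<bar>x n + y n\<bar> powr p \<le> ?b n" for n
    proof -
      have "\<bar>x n + y n\<bar> powr p \<le> (\<bar>x n\<bar> + \<bar>y n\<bar>) powr p"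
        using p by (intro powr_mono2) auto
      also have "\<bar>x n\<bar> + \<bar>y n\<bar> = (A + B) * (s * (\<bar>x n\<bar> / A) + t * (\<bar>y n\<bar> / B))"
        using A B by (simp add: s_def t_def add_divide_distrib[symmetric])
      also have "\<dots> powr p = (A + B) powr p * (s * (\<bar>x n\<bar> / A) + t * (\<bar>y n\<bar> / B)) powr p"
        using A B st by (simp add: powr_mult)
      also have "\<dots> \<le> (A + B) powr p * (s * (\<bar>x n\<bar> / A) powr p + t * (\<bar>y n\<bar> / B) powr p)"
        using A B st p by (intro mult_left_mono powr_convex_nonneg) auto
      also have "\<dots> = ?b n"
        using A B by (simp add: powr_divide)
      finally show ?thesis .
    qed
    have sx: "summable (\<lambda>n. \<bar>x n\<bar> powr p)" and sy: "summable (\<lambda>n. \<bar>y n\<bar> powr p)"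
      using x y by (auto simp: lp_def)
    have norm_le: "(\<Sum>n. \<bar>z n\<bar> powr p) \<le> C powr p"
      if "lp_norm p z \<le> C" "summable (\<lambda>n. \<bar>z n\<bar> powr p)" for z C
    proof -
      have "(\<Sum>n. \<bar>z n\<bar> powr p) = lp_norm p z powr p"
        using p that by (simp add: lp_norm_def powr_powr suminf_nonneg)
      also have "\<dots> \<le> C powr p"
        using that p by (intro powr_mono2) (auto simp: lp_norm_def)
      finally show ?thesis .
    qed
    have bs: "?b sums ((A + B) powr p *
        (s * ((\<Sum>n. \<bar>x n\<bar> powr p) / A powr p) + t * ((\<Sum>n. \<bar>y n\<bar> powr p) / B powr p)))"
      by (intro sums_mult sums_add sums_divide summable_sums sx sy)
    have sb: "summable ?b"
      by (rule sums_summable[OF bs])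
    have s1: "summable (\<lambda>n. \<bar>x n + y n\<bar> powr p)"
      by (rule summable_comparison_test'[OF sb]) (use le in auto)
    have "(\<Sum>n. \<bar>x n + y n\<bar> powr p) \<le> suminf ?b"
      by (intro suminf_le le s1 sb)
    also have "suminf ?b = (A + B) powr p *
        (s * ((\<Sum>n. \<bar>x n\<bar> powr p) / A powr p) + t * ((\<Sum>n. \<bar>y n\<bar> powr p) / B powr p))"
      by (rule sums_unique[OF bs, symmetric])
    also have "\<dots> \<le> (A + B) powr p * (s * 1 + t * 1)"
      using A B st norm_le[OF A(1) sx] norm_le[OF B(1) sy]
      by (intro mult_left_mono add_mono) auto
    also have "\<dots> = (A + B) powr p"
      using st by simp
    finally have "lp_norm p (\<lambda>n. x n + y n) \<le> ((A + B) powr p) powr (1 / p)"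
      unfolding lp_norm_def using p s1 by (intro powr_mono2) (auto intro: suminf_nonneg)
    also have "\<dots> = A + B"
      using A B p by (simp add: powr_powr)
    finally show ?thesis using s1 by simp
  qed
  have nn: "0 \<le> lp_norm p z" for z
    by (simp add: lp_norm_def)
  show "(\<lambda>n. x n + y n) \<in> lp p"
    using main[of "lp_norm p x + 1" "lp_norm p y + 1"] nn[of x] nn[of y] by (simp add: lp_def)
  show "lp_norm p (\<lambda>n. x n + y n) \<le> lp_norm p x + lp_norm p y"
  proof (rule field_le_epsilon)
    fix e :: real assume "0 < e"
    then show "lp_norm p (\<lambda>n. x n + y n) \<le> lp_norm p x + lp_norm p y + e"
      using main[of "lp_norm p x + e / 2" "lp_norm p y + e / 2"] nn[of x] nn[of y] by simp
  qed
qed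

lemma lp_uminus: "x \<in> lp p \<Longrightarrow> (\<lambda>n. - x n) \<in> lp p"
  by (simp add: lp_def)

lemma lp_diff: "1 \<le> p \<Longrightarrow> x \<in> lp p \<Longrightarrow> y \<in> lp p \<Longrightarrow> (\<lambda>n. x n - y n) \<in> lp p"
  using lp_minkowski(1)[of p x "\<lambda>n. - y n"] lp_uminus[of y p] by simp

lemma lp_norm_eq_0:
  assumes "1 \<le> p" "x \<in> lp p"
  shows "lp_norm p x = 0 \<longleftrightarrow> (\<forall>n. x n = 0)"
  using assms suminf_eq_zero_iff[of "\<lambda>n. \<bar>x n\<bar> powr p"] by (auto simp: lp_norm_def lp_def)

lemma Metric_space_lp:
  assumes p: "1 \<le> p"
  shows "Metric_space (lp p) (lp_dist p)"
proof
  show "0 \<le> lp_dist p x y" for x y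
    by (simp add: lp_dist_def lp_norm_def)
  show "lp_dist p x y = lp_dist p y x" for x y
    by (simp add: lp_dist_def lp_norm_def abs_minus_commute)
  show "lp_dist p x y = 0 \<longleftrightarrow> x = y" if "x \<in> lp p" "y \<in> lp p" for x y
    using lp_norm_eq_0[OF p lp_diff[OF p that]] by (auto simp: lp_dist_def)
  show "lp_dist p x z \<le> lp_dist p x y + lp_dist p y z"
    if "x \<in> lp p" "y \<in> lp p" "z \<in> lp p" for x y z
    using lp_minkowski(2)[OF p lp_diff[OF p that(1,2)] lp_diff[OF p that(2,3)]]
    by (simp add: lp_dist_def)
qed

lemma topspace_lp_topology: "1 \<le> p \<Longrightarrow> topspace (lp_topology p) = lp p"
  by (simp add: lp_topology_def Metric_space.topspace_mtopology Metric_space_lp)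


section \<open>Borel measures on a topological space given by a carrier\<close>

definition borel_of :: "'a topology \<Rightarrow> 'a measure" where
  "borel_of X = sigma (topspace X) {U. openin X U}"

definition borel_prob_measure :: "'a topology \<Rightarrow> 'a measure \<Rightarrow> bool" where
  "borel_prob_measure X \<nu> \<longleftrightarrow> prob_space \<nu> \<and> sets \<nu> = sets (borel_of X)"

definition fully_supported :: "'a topology \<Rightarrow> 'a measure \<Rightarrow> bool" where
  "fully_supported X \<nu> \<longleftrightarrow> (\<forall>U. openin X U \<and> U \<noteq> {} \<longrightarrow> emeasure \<nu> U > 0)"


section \<open>Bounded continuous functions and the spectral radius\<close>

text \<open>
  \<^const>\<open>cfunspace\<close> is the space of bounded continuous functions with the supremum
  metric. Its elements are extensional (they are \<open>undefined\<close> outside the carrier),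
  hence the restrictions to \<^term>\<open>topspace X\<close> below.
\<close>

abbreviation Cb :: "'a topology \<Rightarrow> ('a \<Rightarrow> 'b::real_normed_field) set" where
  "Cb X \<equiv> mspace (cfunspace X euclidean_metric)"

definition Cb_norm :: "'a topology \<Rightarrow> ('a \<Rightarrow> 'b::real_normed_field) \<Rightarrow> real" where
  "Cb_norm X h = mdist (cfunspace X euclidean_metric) h (\<lambda>x\<in>topspace X. 0)"

definition bounded_operator ::
  "'a topology \<Rightarrow> (('a \<Rightarrow> 'b::real_normed_field) \<Rightarrow> 'a \<Rightarrow> 'b) \<Rightarrow> bool" where
  "bounded_operator X T \<longleftrightarrow>
     T \<in> Cb X \<rightarrow> Cb X \<and>
     (\<forall>a b. \<forall>g\<in>Cb X. \<forall>h\<in>Cb X.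
        T (\<lambda>x\<in>topspace X. a * g x + b * h x) = (\<lambda>x\<in>topspace X. a * T g x + b * T h x)) \<and>
     (\<exists>K. \<forall>h\<in>Cb X. Cb_norm X (T h) \<le> K * Cb_norm X h)"

definition spectrum ::
  "'a topology \<Rightarrow> (('a \<Rightarrow> 'b::real_normed_field) \<Rightarrow> 'a \<Rightarrow> 'b) \<Rightarrow> 'b set" where
  "spectrum X T = {z. \<not> (\<exists>R. bounded_operator X R \<and>
     (\<forall>h\<in>Cb X. R (\<lambda>x\<in>topspace X. z * h x - T h x) = h \<and>
                (\<lambda>x\<in>topspace X. z * R h x - T (R h) x) = h))}"

text \<open>
  The spectrum of an operator on a real Banach space is the spectrum of its
  complexification; that of the real space \<^term>\<open>Cb X\<close> is the complex one.
\<close>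

definition complexification ::
  "'a topology \<Rightarrow> (('a \<Rightarrow> real) \<Rightarrow> 'a \<Rightarrow> real) \<Rightarrow> ('a \<Rightarrow> complex) \<Rightarrow> 'a \<Rightarrow> complex" where
  "complexification X T h =
     (\<lambda>x\<in>topspace X. Complex (T (\<lambda>y\<in>topspace X. Re (h y)) x) (T (\<lambda>y\<in>topspace X. Im (h y)) x))"

definition spectral_radius :: "'a topology \<Rightarrow> (('a \<Rightarrow> real) \<Rightarrow> 'a \<Rightarrow> real) \<Rightarrow> real" where
  "spectral_radius X T = (SUP z\<in>spectrum X (complexification X T). cmod z)"


section \<open>Transfer operators and conformal measures\<close>

definition transfer_operator ::
  "'a topology \<Rightarrow> ('a \<Rightarrow> 'a measure) \<Rightarrow> ('a \<Rightarrow> real) \<Rightarrow> ('a \<Rightarrow> real) \<Rightarrow> 'a \<Rightarrow> real" where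
  "transfer_operator X M f \<phi> = (\<lambda>x\<in>topspace X. \<integral>y. exp (f y) * \<phi> y \<partial>M x)"

definition conformal_measure ::
  "'a topology \<Rightarrow> (('a \<Rightarrow> real) \<Rightarrow> 'a \<Rightarrow> real) \<Rightarrow> 'a measure \<Rightarrow> bool" where
  "conformal_measure X T \<nu> \<longleftrightarrow> borel_prob_measure X \<nu> \<and>
     (\<forall>\<phi>\<in>Cb X. (\<integral>x. T \<phi> x \<partial>\<nu>) = spectral_radius X T * (\<integral>x. \<phi> x \<partial>\<nu>))"


section \<open>Backward weighted shifts\<close>

definition weighted_shift :: "(nat \<Rightarrow> real) \<Rightarrow> (nat \<Rightarrow> real) \<Rightarrow> (nat \<Rightarrow> real)" where
  "weighted_shift \<alpha> x = (\<lambda>n. \<alpha> n * x (Suc n))"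

definition strongly_transitive :: "real \<Rightarrow> ((nat \<Rightarrow> real) \<Rightarrow> (nat \<Rightarrow> real)) \<Rightarrow> bool" where
  "strongly_transitive p L \<longleftrightarrow>
     (\<forall>U. openin (lp_topology p) U \<and> U \<noteq> {} \<longrightarrow>
          lp p - {\<lambda>n. 0} \<subseteq> (\<Union>n\<in>{1..}. (L ^^ n) ` U))"

definition inverse_weights :: "(nat \<Rightarrow> real) \<Rightarrow> (nat \<Rightarrow> real) \<Rightarrow> (nat \<Rightarrow> real)" where
  "inverse_weights \<alpha> x = (\<lambda>n. inverse (\<alpha> n) * x n)"

text \<open>
  The identification of \<open>\<real> \<times> \<ell>\<^sup>p\<close> with \<open>\<ell>\<^sup>p\<close> is \<^term>\<open>\<lambda>(r, y). case_nat r y\<close>, so the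
  product of \<open>\<mu>\<close> and the point mass at \<open>S x\<close> is the law of \<^term>\<open>case_nat r (S x)\<close>
  when \<open>r\<close> has law \<open>\<mu>\<close>.
\<close>

definition shift_kernel ::
  "real \<Rightarrow> (nat \<Rightarrow> real) \<Rightarrow> real measure \<Rightarrow> (nat \<Rightarrow> real) \<Rightarrow> (nat \<Rightarrow> real) measure" where
  "shift_kernel p \<alpha> \<mu> x =
     distr \<mu> (borel_of (lp_topology p)) (\<lambda>r. case_nat r (inverse_weights \<alpha> x))"

lemma weighted_shift_case_nat:
  assumes "\<And>n. \<alpha> n \<noteq> 0"
  shows "weighted_shift \<alpha> (case_nat r (inverse_weights \<alpha> x)) = x"
  using assms by (simp add: weighted_shift_def inverse_weights_def fun_eq_iff)

lemma inverse_weights_lp: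
  assumes c: "0 < c" "\<And>n. c < \<alpha> n" and p: "1 \<le> p" and x: "x \<in> lp p"
  shows "inverse_weights \<alpha> x \<in> lp p"
proof -
  have "summable (\<lambda>n. inverse c powr p * \<bar>x n\<bar> powr p)"
    using x by (intro summable_mult) (simp add: lp_def)
  moreover have "\<bar>inverse (\<alpha> n) * x n\<bar> powr p \<le> inverse c powr p * \<bar>x n\<bar> powr p" for n
  proof -
    have "\<bar>inverse (\<alpha> n) * x n\<bar> = inverse (\<alpha> n) * \<bar>x n\<bar>"
      using c(1) c(2)[of n] by (simp add: abs_mult)
    also have "\<dots> \<le> inverse c * \<bar>x n\<bar>"
      using c(1) c(2)[of n] by (intro mult_right_mono) (auto intro: le_imp_inverse_le)
    finally have "\<bar>inverse (\<alpha> n) * x n\<bar> powr p \<le> (inverse c * \<bar>x n\<bar>) powr p"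
      using p by (intro powr_mono2) auto
    then show ?thesis using c by (simp add: powr_mult)
  qed
  ultimately show ?thesis
    unfolding lp_def inverse_weights_def mem_Collect_eq
    by (elim summable_comparison_test'[where N = 0]) auto
qed

lemma case_nat_lp:
  assumes "y \<in> lp p"
  shows "case_nat r y \<in> lp p"
  using assms unfolding lp_def mem_Collect_eq by (subst summable_Suc_iff[symmetric]) simp

lemma lp_dist_case_nat:
  assumes p: "1 \<le> p"
  shows "lp_dist p (case_nat r y) (case_nat s y) = \<bar>r - s\<bar>"
proof -
  have "(\<Sum>n. \<bar>case_nat r y n - case_nat s y n\<bar> powr p)
      = (\<Sum>n\<in>{0}. \<bar>case_nat r y n - case_nat s y n\<bar> powr p)"
    by (rule suminf_finite) (auto split: nat.split)
  then show ?thesis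
    using p by (simp add: lp_dist_def lp_norm_def powr_powr)
qed

lemma measurable_case_nat_lp:
  assumes p: "1 \<le> p" and y: "y \<in> lp p"
  shows "(\<lambda>r. case_nat r y) \<in> borel \<rightarrow>\<^sub>M borel_of (lp_topology p)"
  unfolding borel_of_def
proof (rule measurable_measure_of)
  interpret Metric_space "lp p" "lp_dist p"
    by (rule Metric_space_lp[OF p])
  show "{U. openin (lp_topology p) U} \<subseteq> Pow (topspace (lp_topology p))"
    by (auto dest: openin_subset)
  show "(\<lambda>r. case_nat r y) \<in> space borel \<rightarrow> topspace (lp_topology p)"
    using case_nat_lp[OF y] by (simp add: topspace_lp_topology[OF p])
  fix U assume "U \<in> {U. openin (lp_topology p) U}"
  then have U: "openin mtopology U"
    by (simp add: lp_topology_def)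
  have "open ((\<lambda>r. case_nat r y) -` U)"
    unfolding open_dist
  proof
    fix r assume r: "r \<in> (\<lambda>r. case_nat r y) -` U"
    then obtain e where e: "e > 0" "mball (case_nat r y) e \<subseteq> U"
      using U unfolding openin_mtopology by auto
    have "case_nat s y \<in> mball (case_nat r y) e" if "dist s r < e" for s
      using that case_nat_lp[OF y] lp_dist_case_nat[OF p, of r y s]
      by (simp add: dist_real_def abs_minus_commute)
    then show "\<exists>e>0. \<forall>s. dist s r < e \<longrightarrow> s \<in> (\<lambda>r. case_nat r y) -` U"
      using e by blast
  qed
  then show "(\<lambda>r. case_nat r y) -` U \<inter> space borel \<in> sets borel"
    by simp
qed

lemma Cb_borel_measurable:
  fixes h :: "'a \<Rightarrow> real"
  assumes "h \<in> Cb X"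
  shows "h \<in> borel_measurable (borel_of X)"
proof (rule borel_measurableI)
  fix S :: "real set" assume "open S"
  moreover have "continuous_map X euclidean h"
    using assms by simp
  ultimately have "openin X {x \<in> topspace X. h x \<in> S}"
    by (simp add: openin_continuous_map_preimage)
  moreover have "h -` S \<inter> space (borel_of X) = {x \<in> topspace X. h x \<in> S}"
    by (auto simp: borel_of_def space_measure_of_conv)
  moreover have "{U. openin X U} \<subseteq> Pow (topspace X)"
    by (auto dest: openin_subset)
  ultimately show "h -` S \<inter> space (borel_of X) \<in> sets (borel_of X)"
    by (simp add: borel_of_def sets_measure_of sigma_sets.Basic)
qed

text \<open>The explicit formula for the transfer operator of the weighted shift.\<close>

lemma transfer_operator_shift_kernel:
  assumes p: "1 \<le> p" and c: "0 < c" "\<And>n. c < \<alpha> n" and \<mu>: "sets \<mu> = sets borel"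
    and f: "f \<in> Cb (lp_topology p)" and \<phi>: "\<phi> \<in> Cb (lp_topology p)" and x: "x \<in> lp p"
  shows "transfer_operator (lp_topology p) (shift_kernel p \<alpha> \<mu>) f \<phi> x =
    (\<integral>r. exp (f (case_nat r (\<lambda>n. x n / \<alpha> n))) * \<phi> (case_nat r (\<lambda>n. x n / \<alpha> n)) \<partial>\<mu>)"
proof -
  have eq: "inverse_weights \<alpha> x = (\<lambda>n. x n / \<alpha> n)"
    by (simp add: inverse_weights_def field_simps fun_eq_iff)
  have "(\<lambda>r. case_nat r (inverse_weights \<alpha> x)) \<in> \<mu> \<rightarrow>\<^sub>M borel_of (lp_topology p)"
    using measurable_case_nat_lp[OF p inverse_weights_lp[OF c p x]]
    by (simp add: measurable_cong_sets[OF \<mu> refl])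
  moreover have "(\<lambda>y. exp (f y) * \<phi> y) \<in> borel_measurable (borel_of (lp_topology p))"
    using Cb_borel_measurable[OF f] Cb_borel_measurable[OF \<phi>] by measurable
  ultimately show ?thesis
    using x by (simp add: transfer_operator_def shift_kernel_def integral_distr
        topspace_lp_topology[OF p] eq)
qed

end

theory Submission
  imports Defs
begin

text \<open>
  If a continuous \<open>\<phi> \<ge> 0\<close> vanishes almost everywhere for a conformal measure \<open>\<nu>\<close>, then so
  does its image under the transfer operator, and as \<open>\<mu>\<close> is fully supported this image is positive
  exactly on the shift of \<^term>\<open>{x. \<phi> x > (0::real)}\<close>. Starting from a bump function supported in a
  \<open>\<nu>\<close>-null open set, strong transitivity shows that \<open>\<nu>\<close> is concentrated at \<open>0\<close>. One more
  application to \<open>\<phi> x = min 1 \<parallel>x\<parallel>\<close>, which then vanishes almost everywhere although its image is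
  positive everywhere, is a contradiction.
\<close>

section \<open>Bounded continuous functions\<close>

lemma Cb_real_iff:
  fixes g :: "'a \<Rightarrow> real"
  shows "g \<in> Cb X \<longleftrightarrow> g \<in> extensional (topspace X) \<and> continuous_map X euclideanreal g \<and>
    (\<exists>B. \<forall>x\<in>topspace X. \<bar>g x\<bar> \<le> B)"
proof -
  have "Metric_space.mbounded (mspace euclidean_metric) (mdist euclidean_metric) (g ` topspace X)
    \<longleftrightarrow> (\<exists>B. \<forall>x\<in>topspace X. \<bar>g x\<bar> \<le> B)"
    by (simp add: bounded_iff)
  then show ?thesis
    by auto
qed

text \<open>The sequential form is what dominated convergence can supply: it is used to show that
  the transfer operator preserves continuity.\<close>

lemma (in Metric_space) continuous_map_euclidean_sequentially:
  fixes g :: "'a \<Rightarrow> 'b::metric_space"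
  assumes "\<And>x \<sigma>. x \<in> M \<Longrightarrow> range \<sigma> \<subseteq> M \<Longrightarrow> limitin mtopology \<sigma> x sequentially \<Longrightarrow>
    (\<lambda>n. g (\<sigma> n)) \<longlonglongrightarrow> g x"
  shows "continuous_map mtopology euclidean g"
proof -
  interpret Metric_space12 M d UNIV "dist :: 'b \<Rightarrow> 'b \<Rightarrow> real"
    by unfold_locales
  have "limitin euclidean g (g x) (atin mtopology x)" if "x \<in> M" for x
    using limit_atin_sequentially[of g "g x" x] assms[OF that]
    by (auto simp: o_def)
  then show ?thesis
    by (simp add: continuous_map_atin)
qed

lemma Cb_integrable:
  fixes g :: "'a \<Rightarrow> real"
  assumes \<nu>: "borel_prob_measure X \<nu>" and g: "g \<in> Cb X"
  shows "integrable \<nu> g"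
proof -
  interpret prob_space \<nu>
    using \<nu> by (simp add: borel_prob_measure_def)
  have sets: "sets \<nu> = sets (borel_of X)"
    using \<nu> by (simp add: borel_prob_measure_def)
  then have "space \<nu> = topspace X"
    using sets_eq_imp_space_eq[OF sets] by (simp add: borel_of_def space_measure_of_conv)
  moreover have "g \<in> borel_measurable \<nu>"
    using Cb_borel_measurable[OF g] by (simp add: measurable_cong_sets[OF sets refl])
  moreover obtain B where "\<forall>x\<in>topspace X. \<bar>g x\<bar> \<le> B"
    using g unfolding Cb_real_iff by blast
  ultimately show ?thesis
    by (intro integrable_const_bound[where B = B]) auto
qed

lemma Cb_limit:
  fixes g :: "'a \<Rightarrow> real"
  assumes "g \<in> Cb X" and "limitin X \<sigma> x F"
  shows "((\<lambda>n. g (\<sigma> n)) \<longlongrightarrow> g x) F"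
  using continuous_map_limit[of X euclideanreal g \<sigma> x F] assms by (simp add: o_def)

lemma (in Metric_space) continuous_map_dist:
  assumes "a \<in> M"
  shows "continuous_map mtopology euclideanreal (d a)"
  using continuous_on_mdist[of a Self] assms by (simp add: mtopology_of_def)

text \<open>Clamping to [0,1] makes a continuous function bounded, and the restriction makes it
  extensional. It yields the two test functions of the main argument.\<close>

lemma Cb_truncation:
  fixes g :: "'a \<Rightarrow> real"
  assumes g: "continuous_map X euclideanreal g"
  shows "(\<lambda>x\<in>topspace X. max 0 (min 1 (g x))) \<in> Cb X"
  unfolding Cb_real_iff
proof (intro conjI exI[of _ 1] ballI)
  have "continuous_map X euclideanreal (\<lambda>x. max 0 (min 1 (g x)))"
    using g by (intro continuous_intros)
  then show "continuous_map X euclideanreal (\<lambda>x\<in>topspace X. max 0 (min 1 (g x)))"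
    by (rule continuous_map_eq) simp
qed auto

section \<open>The transfer operator of the shift\<close>

lemma weighted_shift_lp:
  assumes \<alpha>: "\<And>n. \<bar>\<alpha> n\<bar> \<le> C" and p: "0 < p" and x: "x \<in> lp p"
  shows "weighted_shift \<alpha> x \<in> lp p"
proof -
  have "summable (\<lambda>n. \<bar>x (Suc n)\<bar> powr p)"
    using x unfolding lp_def mem_Collect_eq by (subst summable_Suc_iff)
  then have "summable (\<lambda>n. C powr p * \<bar>x (Suc n)\<bar> powr p)"
    by (rule summable_mult)
  moreover have "norm (\<bar>\<alpha> n * x (Suc n)\<bar> powr p) \<le> C powr p * \<bar>x (Suc n)\<bar> powr p" for n
    using \<alpha>[of n] p
    by (simp add: abs_mult powr_mult mult_right_mono powr_mono2)
  ultimately show ?thesis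
    unfolding lp_def weighted_shift_def mem_Collect_eq
    by (elim summable_comparison_test'[where N = 0])
qed

text \<open>Prepending the same \<open>r\<close> adds nothing to the difference, and every other
  coordinate of it is divided by a weight larger than \<open>c\<close>. Hence each inverse branch is
  Lipschitz with constant \<open>inverse c\<close>.\<close>

lemma lp_dist_case_nat_inverse_weights_le:
  assumes p: "1 \<le> p" and c: "0 < c" "\<And>n. c < \<alpha> n" and x: "x \<in> lp p" and y: "y \<in> lp p"
  shows "lp_dist p (case_nat r (inverse_weights \<alpha> x)) (case_nat r (inverse_weights \<alpha> y))
    \<le> inverse c * lp_dist p x y"
proof -
  let ?z = "\<lambda>n. x n - y n"
  let ?w = "\<lambda>n. case_nat r (inverse_weights \<alpha> x) n - case_nat r (inverse_weights \<alpha> y) n"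
  have z: "summable (\<lambda>n. \<bar>?z n\<bar> powr p)"
    using lp_diff[OF p x y] by (simp add: lp_def)
  have w: "summable (\<lambda>n. \<bar>?w n\<bar> powr p)"
    using lp_diff[OF p case_nat_lp[OF inverse_weights_lp[OF c p x], where r = r]
        case_nat_lp[OF inverse_weights_lp[OF c p y], where r = r]] by (simp add: lp_def)
  have le: "\<bar>?w (Suc n)\<bar> powr p \<le> inverse c powr p * \<bar>?z n\<bar> powr p" for n
  proof -
    have "\<bar>?w (Suc n)\<bar> = inverse (\<alpha> n) * \<bar>?z n\<bar>"
      using c(1) c(2)[of n]
      by (simp add: inverse_weights_def abs_mult flip: right_diff_distrib)
    also have "\<dots> \<le> inverse c * \<bar>?z n\<bar>"
      using c(1) c(2)[of n] by (intro mult_right_mono) (auto intro: le_imp_inverse_le)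
    finally have "\<bar>?w (Suc n)\<bar> powr p \<le> (inverse c * \<bar>?z n\<bar>) powr p"
      using p by (intro powr_mono2) auto
    then show ?thesis
      using c(1) by (simp add: powr_mult)
  qed
  have w': "summable (\<lambda>n. \<bar>?w (Suc n)\<bar> powr p)"
    using w by (subst summable_Suc_iff)
  \<comment> \<open>The term at index 0 is \<open>\<bar>r - r\<bar> powr p\<close>, and
    \<open>0 powr p\<close> is 0.\<close>
  have "(\<Sum>n. \<bar>?w n\<bar> powr p) = (\<Sum>n. \<bar>?w (Suc n)\<bar> powr p)"
    using suminf_split_head[OF w] by simp
  also have "\<dots> \<le> (\<Sum>n. inverse c powr p * \<bar>?z n\<bar> powr p)"
    by (intro suminf_le le w' summable_mult z)
  also have "\<dots> = inverse c powr p * (\<Sum>n. \<bar>?z n\<bar> powr p)"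
    by (rule suminf_mult[OF z])
  finally have "(\<Sum>n. \<bar>?w n\<bar> powr p) powr (1 / p)
      \<le> (inverse c powr p * (\<Sum>n. \<bar>?z n\<bar> powr p)) powr (1 / p)"
    using p w by (intro powr_mono2) (auto intro: suminf_nonneg)
  also have "\<dots> = inverse c * (\<Sum>n. \<bar>?z n\<bar> powr p) powr (1 / p)"
    using p c(1) z by (simp add: powr_mult powr_powr suminf_nonneg)
  finally show ?thesis
    by (simp add: lp_dist_def lp_norm_def)
qed

lemma limitin_case_nat_inverse_weights:
  assumes p: "1 \<le> p" and c: "0 < c" "\<And>n. c < \<alpha> n" and lim: "limitin (lp_topology p) \<sigma> x F"
  shows "limitin (lp_topology p) (\<lambda>n. case_nat r (inverse_weights \<alpha> (\<sigma> n)))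
    (case_nat r (inverse_weights \<alpha> x)) F"
proof -
  interpret Metric_space "lp p" "lp_dist p"
    by (rule Metric_space_lp[OF p])
  have x: "x \<in> lp p" and ev: "eventually (\<lambda>n. \<sigma> n \<in> lp p) F"
    and lim0: "((\<lambda>n. lp_dist p (\<sigma> n) x) \<longlongrightarrow> 0) F"
    using lim by (auto simp: lp_topology_def limitin_metric_dist_null)
  have lp: "case_nat r (inverse_weights \<alpha> y) \<in> lp p" if "y \<in> lp p" for y
    using case_nat_lp[OF inverse_weights_lp[OF c p that]] .
  have "((\<lambda>n. lp_dist p (case_nat r (inverse_weights \<alpha> (\<sigma> n)))
      (case_nat r (inverse_weights \<alpha> x))) \<longlongrightarrow> 0) F"
  proof (rule tendsto_sandwich[OF _ _ tendsto_const])
    show "((\<lambda>n. inverse c * lp_dist p (\<sigma> n) x) \<longlongrightarrow> 0) F"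
      using tendsto_mult_right_zero[OF lim0] .
    show "\<forall>\<^sub>F n in F. lp_dist p (case_nat r (inverse_weights \<alpha> (\<sigma> n)))
        (case_nat r (inverse_weights \<alpha> x)) \<le> inverse c * lp_dist p (\<sigma> n) x"
      using ev by eventually_elim (rule lp_dist_case_nat_inverse_weights_le[OF p c _ x])
  qed auto
  moreover have "\<forall>\<^sub>F n in F. case_nat r (inverse_weights \<alpha> (\<sigma> n)) \<in> lp p"
    using ev by eventually_elim (rule lp)
  ultimately show ?thesis
    using lp[OF x] by (simp add: lp_topology_def limitin_metric_dist_null)
qed

section \<open>The transfer operator on bounded continuous functions\<close>

locale shift_transfer = prob_space \<mu> for \<mu> :: "real measure" +
  fixes p c :: real and \<alpha> :: "nat \<Rightarrow> real" and f :: "(nat \<Rightarrow> real) \<Rightarrow> real"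
  assumes p: "1 \<le> p" and c: "0 < c" "\<And>n. c < \<alpha> n"
    and sets: "sets \<mu> = sets borel"
    and f: "f \<in> Cb (lp_topology p)"
begin

text \<open>As \<open>r\<close> varies, these are exactly the preimages of \<open>x\<close> under
  the weighted shift; \<open>r\<close> is the coordinate that the shift forgets.\<close>

abbreviation branch :: "real \<Rightarrow> (nat \<Rightarrow> real) \<Rightarrow> nat \<Rightarrow> real" where
  "branch r x \<equiv> case_nat r (inverse_weights \<alpha> x)"

abbreviation transfer :: "((nat \<Rightarrow> real) \<Rightarrow> real) \<Rightarrow> (nat \<Rightarrow> real) \<Rightarrow> real" where
  "transfer \<equiv> transfer_operator (lp_topology p) (shift_kernel p \<alpha> \<mu>) f"

lemma branch_lp: "x \<in> lp p \<Longrightarrow> branch r x \<in> lp p"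
  by (rule case_nat_lp[OF inverse_weights_lp[OF c p]])

lemma transfer_eq:
  assumes "\<phi> \<in> Cb (lp_topology p)" "x \<in> lp p"
  shows "transfer \<phi> x = (\<integral>r. exp (f (branch r x)) * \<phi> (branch r x) \<partial>\<mu>)"
proof -
  have "inverse_weights \<alpha> x = (\<lambda>n. x n / \<alpha> n)"
    by (simp add: inverse_weights_def field_simps fun_eq_iff)
  then show ?thesis
    using transfer_operator_shift_kernel[OF p c sets f assms] by simp
qed

lemma integrand_measurable:
  assumes \<phi>: "\<phi> \<in> Cb (lp_topology p)" and x: "x \<in> lp p"
  shows "(\<lambda>r. exp (f (branch r x)) * \<phi> (branch r x)) \<in> borel_measurable \<mu>"
proof -
  have "(\<lambda>r. branch r x) \<in> \<mu> \<rightarrow>\<^sub>M borel_of (lp_topology p)"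
    using measurable_case_nat_lp[OF p inverse_weights_lp[OF c p x]]
    by (simp add: measurable_cong_sets[OF sets refl])
  moreover have "(\<lambda>y. exp (f y) * \<phi> y) \<in> borel_measurable (borel_of (lp_topology p))"
    using Cb_borel_measurable[OF f] Cb_borel_measurable[OF \<phi>] by measurable
  ultimately show ?thesis
    by (rule measurable_compose)
qed

text \<open>The bound is uniform in \<open>x\<close> and \<open>r\<close>, so one constant gives
  integrability over \<open>r\<close>, bounds the image function, and dominates the integrands in
  the continuity proof.\<close>

lemma integrand_bound:
  assumes "\<phi> \<in> Cb (lp_topology p)"
  obtains B where "\<And>x r. x \<in> lp p \<Longrightarrow> \<bar>exp (f (branch r x)) * \<phi> (branch r x)\<bar> \<le> B"
proof -
  obtain A where A: "\<And>x. x \<in> lp p \<Longrightarrow> \<bar>f x\<bar> \<le> A"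
    using f unfolding Cb_real_iff topspace_lp_topology[OF p] by blast
  obtain B where B: "\<And>x. x \<in> lp p \<Longrightarrow> \<bar>\<phi> x\<bar> \<le> B"
    using assms unfolding Cb_real_iff topspace_lp_topology[OF p] by blast
  have "\<bar>exp (f y) * \<phi> y\<bar> \<le> exp A * B" if "y \<in> lp p" for y
    unfolding abs_mult using A[OF that] B[OF that] by (intro mult_mono) auto
  then show thesis
    using that branch_lp by blast
qed

lemma integrand_integrable:
  assumes \<phi>: "\<phi> \<in> Cb (lp_topology p)" and x: "x \<in> lp p"
  shows "integrable \<mu> (\<lambda>r. exp (f (branch r x)) * \<phi> (branch r x))"
proof -
  obtain B where "\<And>x r. x \<in> lp p \<Longrightarrow> \<bar>exp (f (branch r x)) * \<phi> (branch r x)\<bar> \<le> B"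
    using integrand_bound[OF \<phi>] by blast
  then show ?thesis
    using x integrand_measurable[OF \<phi> x] by (intro integrable_const_bound[where B = B]) auto
qed

lemma transfer_Cb:
  assumes \<phi>: "\<phi> \<in> Cb (lp_topology p)"
  shows "transfer \<phi> \<in> Cb (lp_topology p)"
proof -
  interpret lp: Metric_space "lp p" "lp_dist p"
    by (rule Metric_space_lp[OF p])
  obtain B where B: "\<And>x r. x \<in> lp p \<Longrightarrow> \<bar>exp (f (branch r x)) * \<phi> (branch r x)\<bar> \<le> B"
    using integrand_bound[OF \<phi>] by blast
  have "\<bar>transfer \<phi> x\<bar> \<le> B" if "x \<in> lp p" for x
  proof -
    have "\<bar>transfer \<phi> x\<bar> \<le> (\<integral>r. \<bar>exp (f (branch r x)) * \<phi> (branch r x)\<bar> \<partial>\<mu>)"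
      unfolding transfer_eq[OF \<phi> that] by (rule integral_abs_bound)
    also have "\<dots> \<le> (\<integral>r. B \<partial>\<mu>)"
      using integrand_integrable[OF \<phi> that] B[OF that] by (intro integral_mono) auto
    finally show ?thesis
      by (simp add: prob_space)
  qed
  moreover have "continuous_map (lp_topology p) euclideanreal (transfer \<phi>)"
  proof (rule lp.continuous_map_euclidean_sequentially[folded lp_topology_def])
    fix x \<sigma> assume x: "x \<in> lp p" and \<sigma>: "range \<sigma> \<subseteq> lp p"
      and lim: "limitin (lp_topology p) \<sigma> x sequentially"
    have \<sigma>n: "\<sigma> n \<in> lp p" for n
      using \<sigma> by auto
    have "(\<lambda>n. \<integral>r. exp (f (branch r (\<sigma> n))) * \<phi> (branch r (\<sigma> n)) \<partial>\<mu>)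
        \<longlonglongrightarrow> (\<integral>r. exp (f (branch r x)) * \<phi> (branch r x) \<partial>\<mu>)"
    \<comment> \<open>For each fixed \<open>r\<close> the branches converge, and \<open>f\<close>
      and \<open>\<phi>\<close> are continuous; the constant \<open>B\<close> is integrable because
      \<mu> is a probability measure.\<close>
    proof (rule integral_dominated_convergence[where w = "\<lambda>_. B"])
      show "AE r in \<mu>. (\<lambda>n. exp (f (branch r (\<sigma> n))) * \<phi> (branch r (\<sigma> n)))
          \<longlonglongrightarrow> exp (f (branch r x)) * \<phi> (branch r x)"
        using limitin_case_nat_inverse_weights[of p c \<alpha>, OF p c lim]
        by (intro AE_I2 tendsto_mult tendsto_exp Cb_limit[OF f] Cb_limit[OF \<phi>])
      show "AE r in \<mu>. norm (exp (f (branch r (\<sigma> n))) * \<phi> (branch r (\<sigma> n))) \<le> B" for n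
        using B[OF \<sigma>n] by simp
    qed (simp_all add: integrand_measurable[OF \<phi>] x \<sigma>n)
    then show "(\<lambda>n. transfer \<phi> (\<sigma> n)) \<longlonglongrightarrow> transfer \<phi> x"
      by (simp only: transfer_eq[OF \<phi>] x \<sigma>n)
  qed
  moreover have "transfer \<phi> \<in> extensional (topspace (lp_topology p))"
    by (simp add: transfer_operator_def)
  ultimately show ?thesis
    unfolding Cb_real_iff topspace_lp_topology[OF p] by blast
qed

section \<open>Positivity of the transfer operator\<close>

lemma transfer_nonneg:
  assumes \<phi>: "\<phi> \<in> Cb (lp_topology p)" "\<And>x. x \<in> lp p \<Longrightarrow> 0 \<le> \<phi> x" and x: "x \<in> lp p"
  shows "0 \<le> transfer \<phi> x"
  using \<phi>(2)[OF branch_lp[OF x]] by (simp add: transfer_eq[OF \<phi>(1) x])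

text \<open>A vanishing integral would force the nonnegative integrand to vanish almost everywhere.
  By continuity it is positive on an open set of parameters containing \<open>r\<close>, which has
  positive mass because \<mu> is fully supported.\<close>

lemma transfer_pos:
  assumes full: "fully_supported euclideanreal \<mu>"
    and \<phi>: "\<phi> \<in> Cb (lp_topology p)" "\<And>x. x \<in> lp p \<Longrightarrow> 0 \<le> \<phi> x"
    and x: "x \<in> lp p" and pos: "0 < \<phi> (branch r x)"
  shows "0 < transfer \<phi> x"
proof (rule ccontr)
  interpret lp: Metric_space "lp p" "lp_dist p"
    by (rule Metric_space_lp[OF p])
  let ?g = "\<lambda>s. exp (f (branch s x)) * \<phi> (branch s x)"
  assume "\<not> 0 < transfer \<phi> x"
  then have "(\<integral>s. ?g s \<partial>\<mu>) = 0"
    using transfer_nonneg[OF \<phi> x] by (simp add: transfer_eq[OF \<phi>(1) x])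
  then have ae: "AE s in \<mu>. ?g s = 0"
    using integral_nonneg_eq_0_iff_AE[OF integrand_integrable[OF \<phi>(1) x]]
      \<phi>(2)[OF branch_lp[OF x]] by simp
  \<comment> \<open>For fixed \<open>x\<close> the branches differ only in coordinate 0, so they
    depend isometrically on the parameter.\<close>
  have lim: "limitin (lp_topology p) (\<lambda>s. branch s x) (branch s x) (at s)" for s
    using branch_lp[OF x] tendsto_rabs_zero[OF LIM_zero[OF tendsto_ident_at[of s UNIV]]]
    by (simp add: lp_topology_def lp.limitin_metric_dist_null lp_dist_case_nat[OF p])
  have "continuous_on UNIV (\<lambda>s. \<phi> (branch s x))"
    using Cb_limit[OF \<phi>(1) lim] by (simp add: continuous_on_def)
  then have "open {s. 0 < \<phi> (branch s x)}"
    by (intro open_Collect_less continuous_intros)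
  then have "0 < emeasure \<mu> {s. 0 < \<phi> (branch s x)}"
    using full pos by (auto simp: fully_supported_def)
  moreover have "emeasure \<mu> {s. 0 < \<phi> (branch s x)} = 0"
  proof -
    have "{s. 0 < \<phi> (branch s x)} \<in> sets \<mu>"
      using \<open>open _\<close> by (simp add: sets)
    \<comment> \<open>The exponential factor never vanishes, so a zero of the integrand is a zero of
      \<open>\<phi>\<close>.\<close>
    moreover have "AE s in \<mu>. s \<notin> {s. 0 < \<phi> (branch s x)}"
      using ae by eventually_elim auto
    ultimately show ?thesis
      by (simp add: AE_iff_measurable[OF _ refl] AE_iff_null sets_eq_imp_space_eq[OF sets])
  qed
  ultimately show False
    by simp
qed

text \<open>Since the weights are nonzero, \<open>u\<close> is the branch over its own shift with
  parameter \<open>u 0\<close>.\<close>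

lemma transfer_weighted_shift_pos:
  assumes full: "fully_supported euclideanreal \<mu>"
    and \<phi>: "\<phi> \<in> Cb (lp_topology p)" "\<And>x. x \<in> lp p \<Longrightarrow> 0 \<le> \<phi> x"
    and u: "weighted_shift \<alpha> u \<in> lp p" "0 < \<phi> u"
  shows "0 < transfer \<phi> (weighted_shift \<alpha> u)"
proof (rule transfer_pos[OF full \<phi> u(1)])
  have "branch (u 0) (weighted_shift \<alpha> u) = u"
    using c(1) less_imp_neq[OF less_trans[OF c]]
    by (auto simp: fun_eq_iff weighted_shift_def inverse_weights_def split: nat.split)
  then show "0 < \<phi> (branch (u 0) (weighted_shift \<alpha> u))"
    using u(2) by simp
qed

section \<open>Conformal measures\<close>

lemma transfer_AE_zero:
  assumes conf: "conformal_measure (lp_topology p) transfer \<nu>"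
    and \<phi>: "\<phi> \<in> Cb (lp_topology p)" "\<And>x. x \<in> lp p \<Longrightarrow> 0 \<le> \<phi> x"
    and ae: "AE x in \<nu>. \<phi> x = 0"
  shows "AE x in \<nu>. transfer \<phi> x = 0"
proof -
  have \<nu>: "borel_prob_measure (lp_topology p) \<nu>"
    using conf by (simp add: conformal_measure_def)
  then have space: "space \<nu> = lp p"
    using sets_eq_imp_space_eq[of \<nu> "borel_of (lp_topology p)"]
    by (simp add: borel_prob_measure_def borel_of_def space_measure_of_conv topspace_lp_topology[OF p])
  have "(\<integral>x. \<phi> x \<partial>\<nu>) = 0"
    using ae by (rule integral_eq_zero_AE)
  \<comment> \<open>Conformality makes this integral the spectral radius times 0. As the image is
    nonnegative and integrable, it then vanishes almost everywhere.\<close>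
  then have "(\<integral>x. transfer \<phi> x \<partial>\<nu>) = 0"
    using conf \<phi>(1) unfolding conformal_measure_def by (metis mult_zero_right)
  then show ?thesis
    using integral_nonneg_eq_0_iff_AE[OF Cb_integrable[OF \<nu> transfer_Cb[OF \<phi>(1)]]]
      AE_I2[of \<nu> "\<lambda>x. 0 \<le> transfer \<phi> x"] transfer_nonneg[OF \<phi>] space by blast
qed

lemma conformal_measure_fully_supported:
  assumes bounded: "\<And>n. \<alpha> n \<le> C" and trans: "strongly_transitive p (weighted_shift \<alpha>)"
    and full: "fully_supported euclideanreal \<mu>"
    and conf: "conformal_measure (lp_topology p) transfer \<nu>"
  shows "fully_supported (lp_topology p) \<nu>"
  unfolding fully_supported_def
proof (intro allI impI, rule ccontr)
  let ?L = "weighted_shift \<alpha>"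
  interpret lp: Metric_space "lp p" "lp_dist p"
    by (rule Metric_space_lp[OF p])
  have \<nu>: "prob_space \<nu>" and sets_\<nu>: "sets \<nu> = sets (borel_of (lp_topology p))"
    using conf by (simp_all add: conformal_measure_def borel_prob_measure_def)
  have space: "space \<nu> = lp p"
    using sets_eq_imp_space_eq[OF sets_\<nu>]
    by (simp add: borel_of_def space_measure_of_conv topspace_lp_topology[OF p])
  \<comment> \<open>The upper bound on the weights keeps orbits of the shift inside
    \<open>lp p\<close>.\<close>
  have L: "?L x \<in> lp p" if "x \<in> lp p" for x
  proof (rule weighted_shift_lp[where C = C, OF _ _ that])
    fix n show "\<bar>\<alpha> n\<bar> \<le> C"
      using bounded[of n] c(1) c(2)[of n] by simp
  qed (use p in simp)
  fix U assume U: "openin (lp_topology p) U \<and> U \<noteq> {}" and "\<not> 0 < emeasure \<nu> U"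
  then have "emeasure \<nu> U = 0"
    by simp
  moreover have "U \<in> sets \<nu>"
    using U openin_subset[of "lp_topology p"]
    by (subst sets_\<nu>) (auto simp: borel_of_def intro!: in_sets_SUP in_measure_of)
  ultimately have U0: "AE x in \<nu>. x \<notin> U"
    by (intro AE_not_in null_setsI)
  obtain u e where u: "u \<in> U" "u \<in> lp p" and e: "0 < e" "lp.mball u e \<subseteq> U"
    using U unfolding lp_topology_def lp.openin_mtopology by blast
  \<comment> \<open>Within \<open>lp p\<close> this is positive exactly on the ball of radius
    \<open>e\<close> around \<open>u\<close>, which lies in the null set \<open>U\<close>.\<close>
  define bump where "bump = (\<lambda>x\<in>lp p. max 0 (min 1 (e - lp_dist p u x)))"
  have bump: "bump \<in> Cb (lp_topology p)" "\<And>x. x \<in> lp p \<Longrightarrow> 0 \<le> bump x"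
    using Cb_truncation[OF continuous_map_diff[OF _ lp.continuous_map_dist[OF u(2)]], of "\<lambda>_. e"]
    by (auto simp: bump_def topspace_lp_topology[OF p, unfolded lp_topology_def] lp_topology_def
        simp del: mspace_cfunspace)
  \<comment> \<open>The first two conjuncts let the transfer lemmas be applied again. The other two
    are the conflict being built: the iterate is zero almost everywhere, yet positive on the
    \<open>n\<close>-th shift image of the ball.\<close>
  have iter: "(transfer ^^ n) bump \<in> Cb (lp_topology p)
      \<and> (\<forall>x\<in>lp p. 0 \<le> (transfer ^^ n) bump x) \<and> (AE x in \<nu>. (transfer ^^ n) bump x = 0)
      \<and> (\<forall>x\<in>lp.mball u e. (?L ^^ n) x \<in> lp p \<and> 0 < (transfer ^^ n) bump ((?L ^^ n) x))" for n
  proof (induction n)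
    case 0
    have "AE x in \<nu>. bump x = 0"
      using U0 AE_space by eventually_elim (use e(2) u(2) in \<open>auto simp: bump_def space subset_iff\<close>)
    moreover have "\<forall>x\<in>lp.mball u e. x \<in> lp p \<and> 0 < bump x"
      by (simp add: bump_def)
    ultimately show ?case
      using bump by simp
  next
    case (Suc n)
    then have *: "(transfer ^^ n) bump \<in> Cb (lp_topology p)"
      "\<And>x. x \<in> lp p \<Longrightarrow> 0 \<le> (transfer ^^ n) bump x"
      by auto
    from Suc show ?case
      using transfer_Cb[OF *(1)] transfer_nonneg[OF *] transfer_AE_zero[OF conf *]
        transfer_weighted_shift_pos[OF full *] L by (simp del: mspace_cfunspace)
  qed
  \<comment> \<open>Strong transitivity is applied to the ball, where the bump is positive.\<close>
  have cover: "\<exists>n. 0 < (transfer ^^ n) bump x" if x: "x \<in> lp p" "x \<noteq> (\<lambda>_. 0)" for x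
  proof -
    have "openin (lp_topology p) (lp.mball u e)" "lp.mball u e \<noteq> {}"
      using u(2) e(1) by (auto simp: lp_topology_def)
    then have "lp p - {\<lambda>_. 0} \<subseteq> (\<Union>n\<in>{1..}. (?L ^^ n) ` lp.mball u e)"
      using trans unfolding strongly_transitive_def by blast
    then obtain n y where "y \<in> lp.mball u e" "x = (?L ^^ n) y"
      using x by blast
    then show ?thesis
      using iter[of n] by blast
  qed
  \<comment> \<open>Countably many null sets are united; by \<open>cover\<close>, only the origin
    can lie outside their union.\<close>
  have "AE x in \<nu>. \<forall>n. (transfer ^^ n) bump x = 0"
    using iter by (simp add: AE_all_countable)
  then have zero: "AE x in \<nu>. x = (\<lambda>_. 0)"
    using AE_space
  proof eventually_elim
    case (elim x)
    then show ?case
      using cover[of x] by (auto simp: space)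
  qed
  have zero_lp: "(\<lambda>_. 0) \<in> lp p"
    by (simp add: lp_def)
  \<comment> \<open>On \<open>lp p\<close> this vanishes only at the origin, where all the mass of
    \<open>\<nu>\<close> now sits.\<close>
  define h where "h = (\<lambda>x\<in>lp p. max 0 (min 1 (lp_dist p (\<lambda>_. 0) x)))"
  have h: "h \<in> Cb (lp_topology p)" "\<And>x. x \<in> lp p \<Longrightarrow> 0 \<le> h x"
    using Cb_truncation[of "lp_topology p" "lp_dist p (\<lambda>_. 0)"] lp.continuous_map_dist[OF zero_lp]
    by (auto simp: h_def topspace_lp_topology[OF p, unfolded lp_topology_def] lp_topology_def
        simp del: mspace_cfunspace)
  have "AE x in \<nu>. h x = 0"
    using zero by eventually_elim (simp add: h_def zero_lp)
  then have "AE x in \<nu>. transfer h x = 0"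
    by (intro transfer_AE_zero[OF conf] h)
  moreover have "0 < transfer h x" if x: "x \<in> lp p" for x
  \<comment> \<open>The parameter 1 gives a preimage whose coordinate 0 is 1; it is nonzero even
    when \<open>x\<close> is the origin.\<close>
  proof (rule transfer_pos[OF full h x])
    have "branch 1 x 0 = 1"
      by simp
    then have "branch 1 x \<noteq> (\<lambda>_. 0)"
      by (metis zero_neq_one)
    then have "0 < lp_dist p (\<lambda>_. 0) (branch 1 x)"
      using zero_lp branch_lp[OF x] lp.mdist_pos_eq by metis
    then show "0 < h (branch 1 x)"
      using branch_lp[OF x] by (simp add: h_def)
  qed
  ultimately have "AE x in \<nu>. False"
    using AE_space by (elim AE_mp) (force intro!: AE_I2 simp: space)
  then show False
    using prob_space.AE_False[OF \<nu>] by simp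
qed

end

theorem theorem3p5:
  fixes p c c' :: real
    and \<alpha> :: "nat \<Rightarrow> real"
    and \<mu> :: "real measure"
    and f :: "(nat \<Rightarrow> real) \<Rightarrow> real"
    and \<nu> :: "(nat \<Rightarrow> real) measure"
  assumes "1 \<le> p"
    and "0 < c" and "c < c'"
    and "\<And>n. \<alpha> n \<in> {c<..<c'}"
    and "strongly_transitive p (weighted_shift \<alpha>)"
    and "borel_prob_measure euclideanreal \<mu>"
    and "fully_supported euclideanreal \<mu>"
    and "f \<in> Cb (lp_topology p)"
    and "conformal_measure (lp_topology p)
           (transfer_operator (lp_topology p) (shift_kernel p \<alpha> \<mu>) f) \<nu>"
  shows "fully_supported (lp_topology p) \<nu>"
proof -
  \<comment> \<open>Translates the Borel condition on \<mu> into the form that the locale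
    assumes.\<close>
  have "sets (borel_of euclideanreal) = sets borel"
    by (simp add: borel_of_def borel_def)
  then interpret shift_transfer \<mu> p c \<alpha> f
    using assms by (simp add: shift_transfer_def shift_transfer_axioms_def borel_prob_measure_def)
  show ?thesis
    using conformal_measure_fully_supported[of c'] assms by (simp add: less_imp_le)
qed

end
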